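(* Let $(X,G,\Phi)$ be a dynamical system, where $X$ is a compact metric space, and let $S$ be a finite subset of $G$. If $\Phi$ has the $S$-shadowing property, then there exists an inverse system $(\phi^{n+1}_n,(X_n,G,\sigma))_{n\in\mathbb N}$ consisting of shifts of finite type $X_n$ over $S\cup\{e_G\}$ such that $(X,G,\Phi)$ is a factor of its inverse limit $(\varprojlim\{\phi^{n+1}_n,X_n\},G,\sigma^* )$.
   Context: $G$ is a countable discrete group with identity $e_G$. A dynamical system $(X,G,\Phi)$ consists of a compact Hausdorff space $X$ and $\Phi:G\times X\to X$ such that each $\Phi_g:=\Phi(g,\cdot)$ is a homeomorphism, $\Phi_{e_G}=\mathrm{id}_X$ and $\Phi_{gg'}=\Phi_g\circ\Phi_{g'}$. Shadowing (metric $d$ on $X$). For $S\subset G$ and $\delta>0$, an $(S,\delta)$-pseudo-orbit is a family $\{x_g\}_{g\in G}$ in $X$ with $d(\Phi_s(x_g),x_{sg})<\delta$ for all $g\in G$, $s\in S$. A point $z\in X$ $\varepsilon$-shadows $\{x_g\}_{g\in G}$ if $d(\Phi_g(z),x_g)<\varepsilon$ for all $g\in G$. $\Phi$ has the $S$-shadowing property if for every $\varepsilon>0$ there is $\delta>0$ such that every $(S,\delta)$-pseudo-orbit is $\varepsilon$-shadowed by some point of $X$. Subshifts. For a finite set $\Sigma$, $G$ acts on $\Sigma^G$ (product topology, $\Sigma$ discrete) by $\sigma_g(x)(h)=x(hg)$. A subshift is a closed $G$-invariant subset of some $\Sigma^G$, regarded as a dynamical system under $\sigma$. For $A\subset G$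 and $P\in\Sigma^A$ let $C(P)=\{y\in\Sigma^G: y(g)=P(g)\ \forall g\in A\}$. For finite $A\subset G$, a subshift $Y\subset\Sigma^G$ is a shift of finite type over $A$ if there is $\mathcal F\subset\Sigma^A$ with $Y=\{x\in\Sigma^G:\sigma_g(x)\notin C(P)\text{ for all }g\in G,\ P\in\mathcal F\}$. The alphabet $\Sigma$ may depend on $n$ for the $X_n$. Inverse limits. An inverse system $(\phi^{n+1}_n,(X_n,G,\sigma))$ consists of the systems $X_n$ and continuous $G$-equivariant maps $\phi^{n+1}_n:X_{n+1}\to X_n$. The inverse limit $\varprojlim\{\phi^{n+1}_n,X_n\}$ is the space of all $(x_n)\in\prod_n X_n$ with $x_n=\phi^{n+1}_n(x_{n+1})$ for all $n$, with the subspace topology, and $\sigma^*$ is the coordinatewise $G$-action. $(Y,G,\Phi^Y)$ is a factor of $(Z,G,\Phi^Z)$ if there is a continuous surjection $\phi:Z\to Y$ with $\Phi^Y_g\circ\phi=\phi\circ\Phi^Z_g$ for all $g\in G$. *)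

theory Defs
  imports "HOL-Analysis.Analysis" "HOL-Algebra.Group"
begin

section \<open>Dynamical systems and factors\<close>

locale dynamical_system = group G
  for G :: "('g, 'm) monoid_scheme" (structure) +
  fixes X :: "'a topology" and \<Phi> :: "'g \<Rightarrow> 'a \<Rightarrow> 'a"
  assumes countable_group: "countable (carrier G)"
    and compact: "compact_space X"
    and Hausdorff: "Hausdorff_space X"
    and homeo: "g \<in> carrier G \<Longrightarrow> homeomorphic_map X X (\<Phi> g)"
    and act_one: "x \<in> topspace X \<Longrightarrow> \<Phi> \<one> x = x"
    and act_mult: "\<lbrakk>g \<in> carrier G; g' \<in> carrier G; x \<in> topspace X\<rbrakk>
                     \<Longrightarrow> \<Phi> (g \<otimes> g') x = \<Phi> g (\<Phi> g' x)"

definition factor_of ::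
  "('g, 'm) monoid_scheme \<Rightarrow> 'a topology \<Rightarrow> ('g \<Rightarrow> 'a \<Rightarrow> 'a)
    \<Rightarrow> 'b topology \<Rightarrow> ('g \<Rightarrow> 'b \<Rightarrow> 'b) \<Rightarrow> bool"
  where "factor_of G Y \<Phi>Y Z \<Phi>Z \<longleftrightarrow>
    dynamical_system G Y \<Phi>Y \<and> dynamical_system G Z \<Phi>Z \<and>
    (\<exists>\<phi>. continuous_map Z Y \<phi> \<and> \<phi> ` topspace Z = topspace Y \<and>
         (\<forall>g\<in>carrier G. \<forall>z\<in>topspace Z. \<Phi>Y g (\<phi> z) = \<phi> (\<Phi>Z g z)))"

section \<open>Shadowing\<close>

text \<open>Families indexed by the group are functions whose values outside
  \<^term>\<open>carrier G\<close> are irrelevant.\<close>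

definition pseudo_orbit ::
  "('g, 'm) monoid_scheme \<Rightarrow> 'a set \<Rightarrow> ('a \<Rightarrow> 'a \<Rightarrow> real) \<Rightarrow> ('g \<Rightarrow> 'a \<Rightarrow> 'a)
    \<Rightarrow> 'g set \<Rightarrow> real \<Rightarrow> ('g \<Rightarrow> 'a) \<Rightarrow> bool"
  where "pseudo_orbit G M d \<Phi> S \<delta> x \<longleftrightarrow>
    x \<in> carrier G \<rightarrow> M \<and>
    (\<forall>g\<in>carrier G. \<forall>s\<in>S. d (\<Phi> s (x g)) (x (s \<otimes>\<^bsub>G\<^esub> g)) < \<delta>)"

definition shadows ::
  "('g, 'm) monoid_scheme \<Rightarrow> ('a \<Rightarrow> 'a \<Rightarrow> real) \<Rightarrow> ('g \<Rightarrow> 'a \<Rightarrow> 'a)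
    \<Rightarrow> real \<Rightarrow> 'a \<Rightarrow> ('g \<Rightarrow> 'a) \<Rightarrow> bool"
  where "shadows G d \<Phi> \<epsilon> z x \<longleftrightarrow> (\<forall>g\<in>carrier G. d (\<Phi> g z) (x g) < \<epsilon>)"

definition shadowing_property ::
  "('g, 'm) monoid_scheme \<Rightarrow> 'a set \<Rightarrow> ('a \<Rightarrow> 'a \<Rightarrow> real) \<Rightarrow> ('g \<Rightarrow> 'a \<Rightarrow> 'a)
    \<Rightarrow> 'g set \<Rightarrow> bool"
  where "shadowing_property G M d \<Phi> S \<longleftrightarrow>
    (\<forall>\<epsilon>>0. \<exists>\<delta>>0. \<forall>x. pseudo_orbit G M d \<Phi> S \<delta> x \<longrightarrow> (\<exists>z\<in>M. shadows G d \<Phi> \<epsilon> z x))"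

section \<open>Subshifts\<close>

text \<open>The full shift consists of the extensional functions from \<^term>\<open>carrier G\<close> to the
  alphabet, so the action has to restrict its result to \<^term>\<open>carrier G\<close>.\<close>

definition full_shift :: "('g, 'm) monoid_scheme \<Rightarrow> 's set \<Rightarrow> ('g \<Rightarrow> 's) topology"
  where "full_shift G \<Sigma> = product_topology (\<lambda>_. discrete_topology \<Sigma>) (carrier G)"

definition shift_act :: "('g, 'm) monoid_scheme \<Rightarrow> 'g \<Rightarrow> ('g \<Rightarrow> 's) \<Rightarrow> 'g \<Rightarrow> 's"
  where "shift_act G g x = (\<lambda>h\<in>carrier G. x (h \<otimes>\<^bsub>G\<^esub> g))"

definition subshift :: "('g, 'm) monoid_scheme \<Rightarrow> 's set \<Rightarrow> ('g \<Rightarrow> 's) set \<Rightarrow> bool"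
  where "subshift G \<Sigma> Y \<longleftrightarrow>
    finite \<Sigma> \<and> closedin (full_shift G \<Sigma>) Y \<and> (\<forall>g\<in>carrier G. shift_act G g ` Y \<subseteq> Y)"

definition subshift_space ::
  "('g, 'm) monoid_scheme \<Rightarrow> 's set \<Rightarrow> ('g \<Rightarrow> 's) set \<Rightarrow> ('g \<Rightarrow> 's) topology"
  where "subshift_space G \<Sigma> Y = subtopology (full_shift G \<Sigma>) Y"

definition cylinder ::
  "('g, 'm) monoid_scheme \<Rightarrow> 's set \<Rightarrow> 'g set \<Rightarrow> ('g \<Rightarrow> 's) \<Rightarrow> ('g \<Rightarrow> 's) set"
  where "cylinder G \<Sigma> A P = {y \<in> topspace (full_shift G \<Sigma>). \<forall>g\<in>A. y g = P g}"

definition shift_of_finite_type ::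
  "('g, 'm) monoid_scheme \<Rightarrow> 's set \<Rightarrow> 'g set \<Rightarrow> ('g \<Rightarrow> 's) set \<Rightarrow> bool"
  where "shift_of_finite_type G \<Sigma> A Y \<longleftrightarrow>
    finite A \<and> A \<subseteq> carrier G \<and> subshift G \<Sigma> Y \<and>
    (\<exists>\<F> \<subseteq> (A \<rightarrow>\<^sub>E \<Sigma>). Y = {x \<in> topspace (full_shift G \<Sigma>).
        \<forall>g\<in>carrier G. \<forall>P\<in>\<F>. shift_act G g x \<notin> cylinder G \<Sigma> A P})"

section \<open>Inverse limits\<close>

text \<open>The bonding map \<open>\<phi> n\<close> goes from \<open>X (Suc n)\<close> to \<open>X n\<close>.\<close>

definition inverse_system ::
  "('g, 'm) monoid_scheme \<Rightarrow> (nat \<Rightarrow> 'a topology) \<Rightarrow> (nat \<Rightarrow> 'g \<Rightarrow> 'a \<Rightarrow> 'a)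
    \<Rightarrow> (nat \<Rightarrow> 'a \<Rightarrow> 'a) \<Rightarrow> bool"
  where "inverse_system G X \<Phi> \<phi> \<longleftrightarrow>
    (\<forall>n. dynamical_system G (X n) (\<Phi> n)) \<and>
    (\<forall>n. continuous_map (X (Suc n)) (X n) (\<phi> n)) \<and>
    (\<forall>n. \<forall>g\<in>carrier G. \<forall>x\<in>topspace (X (Suc n)). \<phi> n (\<Phi> (Suc n) g x) = \<Phi> n g (\<phi> n x))"

definition inverse_limit ::
  "(nat \<Rightarrow> 'a topology) \<Rightarrow> (nat \<Rightarrow> 'a \<Rightarrow> 'a) \<Rightarrow> (nat \<Rightarrow> 'a) topology"
  where "inverse_limit X \<phi> =
    subtopology (product_topology X UNIV) {x. \<forall>n. x n = \<phi> n (x (Suc n))}"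

definition coordinatewise_act ::
  "(nat \<Rightarrow> 'g \<Rightarrow> 'a \<Rightarrow> 'a) \<Rightarrow> 'g \<Rightarrow> (nat \<Rightarrow> 'a) \<Rightarrow> nat \<Rightarrow> 'a"
  where "coordinatewise_act \<Phi> g x = (\<lambda>n. \<Phi> n g (x n))"

end

theory Submission imports Defs begin

text \<open>Color \<open>X\<close> by finer and finer finite colorings \<open>c n\<close> whose color classes have diameters tending
  to \<open>0\<close>; no topological condition on the classes is needed. Let \<open>X\<^sub>n\<close> consist of the families
  of colors \<open>u\<close> such that for all \<open>g \<in> G\<close> and \<open>s \<in> S\<close> some point \<open>x\<close> has color \<open>u g\<close> while \<open>\<Phi> s x\<close>
  has color \<open>u (s g)\<close>; the bonding maps forget the refinement letter by letter. In a point of the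
  inverse limit the color classes at \<open>g\<close> are nested, so they close in on a single point
  \<open>y g\<close>, and the factor map is \<open>u \<mapsto> y 1\<close>. It is onto because itineraries of points lie in every
  \<open>X\<^sub>n\<close>. For equivariance one needs \<open>y g = \<Phi> g (y 1)\<close>: representatives of the colors at a high level
  \<open>n\<close> form an \<open>(S, \<delta>)\<close>-pseudo-orbit, and the orbit of a shadowing point is close to \<open>y\<close>
  at both \<open>1\<close> and \<open>g\<close>.\<close>

lemma eq_CollectI: "\<lbrakk>\<And>x. x \<in> B \<Longrightarrow> x \<in> A \<longleftrightarrow> P x; A \<subseteq> B\<rbrakk> \<Longrightarrow> A = {x \<in> B. P x}"
  by blast

section \<open>Constructions of dynamical systems\<close>

text \<open>Continuity of each single map suffices: \<open>\<Phi> (inv g)\<close> is continuous as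
  well and, by the action laws, is a two-sided inverse of \<open>\<Phi> g\<close>.\<close>

lemma (in group) dynamical_systemI:
  assumes "countable (carrier G)" "compact_space X" "Hausdorff_space X"
    and cont: "\<And>g. g \<in> carrier G \<Longrightarrow> continuous_map X X (\<Phi> g)"
    and one: "\<And>x. x \<in> topspace X \<Longrightarrow> \<Phi> \<one> x = x"
    and mult: "\<And>g h x. \<lbrakk>g \<in> carrier G; h \<in> carrier G; x \<in> topspace X\<rbrakk>
                 \<Longrightarrow> \<Phi> (g \<otimes> h) x = \<Phi> g (\<Phi> h x)"
  shows "dynamical_system G X \<Phi>"
proof
  fix g assume g: "g \<in> carrier G"
  have "homeomorphic_maps X X (\<Phi> g) (\<Phi> (inv g))"
    unfolding homeomorphic_maps_def
    using g cont mult[of g "inv g", symmetric] mult[of "inv g" g, symmetric] one by simp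
  then show "homeomorphic_map X X (\<Phi> g)"
    by (auto simp: homeomorphic_map_maps)
qed (simp_all add: assms)

lemma (in dynamical_system) continuous_act:
  "g \<in> carrier G \<Longrightarrow> continuous_map X X (\<Phi> g)"
  using homeo homeomorphic_imp_continuous_map by blast

lemma (in dynamical_system) act_closed:
  "\<lbrakk>g \<in> carrier G; x \<in> topspace X\<rbrakk> \<Longrightarrow> \<Phi> g x \<in> topspace X"
  using continuous_act continuous_map_image_subset_topspace by fastforce

lemma (in dynamical_system) dynamical_system_subtopology:
  assumes "closedin X Y" and inv: "\<And>g. g \<in> carrier G \<Longrightarrow> \<Phi> g ` Y \<subseteq> Y"
  shows "dynamical_system G (subtopology X Y) \<Phi>"
proof (rule dynamical_systemI)
  show "compact_space (subtopology X Y)"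
    by (intro compact_space_subtopology closedin_compact_space compact assms(1))
  show "continuous_map (subtopology X Y) (subtopology X Y) (\<Phi> g)" if "g \<in> carrier G" for g
    using inv[OF that]
    by (intro continuous_map_into_subtopology continuous_map_from_subtopology continuous_act[OF that]) auto
qed (simp_all add: countable_group Hausdorff Hausdorff_space_subtopology act_one act_mult)

lemma (in group) dynamical_system_product:
  assumes "countable (carrier G)" and X: "\<And>i. dynamical_system G (X i) (\<Phi> i)"
  shows "dynamical_system G (product_topology X UNIV) (coordinatewise_act \<Phi>)"
proof (rule dynamical_systemI)
  show "compact_space (product_topology X UNIV)"
    using dynamical_system.compact[OF X] by (simp add: compact_space_product_topology)
  show "Hausdorff_space (product_topology X UNIV)"
    using dynamical_system.Hausdorff[OF X] by (simp add: Hausdorff_space_product_topology)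
  show "continuous_map (product_topology X UNIV) (product_topology X UNIV) (coordinatewise_act \<Phi> g)"
    if g: "g \<in> carrier G" for g
    unfolding continuous_map_componentwise_UNIV coordinatewise_act_def
    using continuous_map_compose[OF continuous_map_product_projection[of _ UNIV X]
        dynamical_system.continuous_act[OF X g]]
    by (simp add: o_def)
qed (simp_all add: assms(1) coordinatewise_act_def PiE_iff
      dynamical_system.act_one[OF X] dynamical_system.act_mult[OF X])

text \<open>The limit is an intersection of equalizers of continuous maps into Hausdorff spaces,
  hence closed in the compact product; equivariance of the bonding maps makes it invariant.\<close>

lemma (in group) dynamical_system_inverse_limit:
  assumes countable: "countable (carrier G)" and sys: "inverse_system G X \<Phi> \<phi>"
  shows "dynamical_system G (inverse_limit X \<phi>) (coordinatewise_act \<Phi>)"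
proof -
  let ?P = "product_topology X UNIV"
  have X: "\<And>n. dynamical_system G (X n) (\<Phi> n)"
    and \<phi>: "\<And>n. continuous_map (X (Suc n)) (X n) (\<phi> n)"
    and equi: "\<And>n g x. \<lbrakk>g \<in> carrier G; x \<in> topspace (X (Suc n))\<rbrakk>
                 \<Longrightarrow> \<phi> n (\<Phi> (Suc n) g x) = \<Phi> n g (\<phi> n x)"
    using sys by (auto simp: inverse_system_def)
  interpret P: dynamical_system G ?P "coordinatewise_act \<Phi>"
    using dynamical_system_product countable X .
  let ?L = "{x \<in> topspace ?P. \<forall>n. x n = \<phi> n (x (Suc n))}"
  have "closedin ?P {x \<in> topspace ?P. x n = \<phi> n (x (Suc n))}" for n
  proof (rule closedin_continuous_maps_eq)
    show "Hausdorff_space (X n)"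
      using dynamical_system.Hausdorff[OF X] .
    show "continuous_map ?P (X n) (\<lambda>x. \<phi> n (x (Suc n)))"
      using continuous_map_compose[OF continuous_map_product_projection[of "Suc n" UNIV X] \<phi>]
      by (simp add: o_def)
  qed (simp add: continuous_map_product_projection)
  then have "closedin ?P (\<Inter>n. {x \<in> topspace ?P. x n = \<phi> n (x (Suc n))})"
    by blast
  also have "(\<Inter>n. {x \<in> topspace ?P. x n = \<phi> n (x (Suc n))}) = ?L"
    by blast
  finally have "closedin ?P ?L" .
  moreover have "coordinatewise_act \<Phi> g x \<in> ?L" if g: "g \<in> carrier G" and x: "x \<in> ?L" for g x
  proof -
    have "x (Suc n) \<in> topspace (X (Suc n))" for n
      using x unfolding topspace_product_topology by blast
    moreover have "x n = \<phi> n (x (Suc n))" for n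
      using x by blast
    ultimately have "\<Phi> n g (x n) = \<phi> n (\<Phi> (Suc n) g (x (Suc n)))" for n
      by (metis equi g)
    moreover have "coordinatewise_act \<Phi> g x \<in> topspace ?P"
      using P.act_closed g x by blast
    ultimately show ?thesis
      unfolding coordinatewise_act_def by blast
  qed
  ultimately have "dynamical_system G (subtopology ?P ?L) (coordinatewise_act \<Phi>)"
    by (intro P.dynamical_system_subtopology image_subsetI)
  also have "subtopology ?P ?L = inverse_limit X \<phi>"
    using subtopology_restrict[of ?P "{x. \<forall>n. x n = \<phi> n (x (Suc n))}"]
    by (simp only: inverse_limit_def Collect_conj_eq Collect_mem_eq)
  finally show ?thesis .
qed

section \<open>Full shifts and subshifts given by forbidden patterns\<close>

lemma topspace_full_shift [simp]:
  "topspace (full_shift G \<Sigma>) = (carrier G \<rightarrow>\<^sub>E \<Sigma>)"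
  by (simp add: full_shift_def)

lemma continuous_map_full_shift_coordinate:
  "h \<in> carrier G \<Longrightarrow> continuous_map (full_shift G \<Sigma>) (discrete_topology \<Sigma>) (\<lambda>x. x h)"
  unfolding full_shift_def by (rule continuous_map_product_projection)

lemma continuous_map_into_full_shift:
  assumes "\<And>h. h \<in> carrier G \<Longrightarrow> continuous_map Z (discrete_topology \<Sigma>) (\<lambda>x. f x h)"
    and "\<And>x. f x \<in> extensional (carrier G)"
  shows "continuous_map Z (full_shift G \<Sigma>) f"
  unfolding full_shift_def continuous_map_componentwise using assms by blast

lemma (in group) dynamical_system_full_shift:
  fixes \<Sigma> :: "'s set"
  assumes "countable (carrier G)" "finite \<Sigma>"
  shows "dynamical_system G (full_shift G \<Sigma>) (shift_act G)"
proof (rule dynamical_systemI)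
  show "compact_space (full_shift G \<Sigma>)"
    using assms
    by (simp add: full_shift_def compact_space_product_topology compact_space_discrete_topology)
  show "Hausdorff_space (full_shift G \<Sigma>)"
    by (simp add: full_shift_def Hausdorff_space_product_topology)
  show "continuous_map (full_shift G \<Sigma>) (full_shift G \<Sigma>) (shift_act G g)"
    if "g \<in> carrier G" for g
  proof (rule continuous_map_into_full_shift)
    show "continuous_map (full_shift G \<Sigma>) (discrete_topology \<Sigma>) (\<lambda>x. shift_act G g x h)"
      if "h \<in> carrier G" for h
      using continuous_map_full_shift_coordinate[of "h \<otimes> g" G \<Sigma>] that \<open>g \<in> carrier G\<close>
      by (simp add: shift_act_def)
  qed (simp add: shift_act_def)
  show "shift_act G \<one> x = x" if "x \<in> topspace (full_shift G \<Sigma>)" for x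
  proof
    fix h
    show "shift_act G \<one> x h = x h"
      using PiE_arb[of x "carrier G" "\<lambda>_. \<Sigma>" h] that
      by (cases "h \<in> carrier G") (auto simp: shift_act_def)
  qed
  show "shift_act G (g \<otimes> h) x = shift_act G g (shift_act G h x)"
    if "g \<in> carrier G" "h \<in> carrier G" for g h and x :: "'a \<Rightarrow> 's"
    using that by (auto simp: shift_act_def m_assoc)
qed (simp_all add: assms)

lemma (in group) dynamical_system_subshift:
  assumes "countable (carrier G)" "subshift G \<Sigma> Y"
  shows "dynamical_system G (subshift_space G \<Sigma> Y) (shift_act G)"
  using assms dynamical_system.dynamical_system_subtopology[OF dynamical_system_full_shift]
  unfolding subshift_def subshift_space_def by blast

lemma openin_cylinder:
  assumes "finite A" "A \<subseteq> carrier G"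
  shows "openin (full_shift G \<Sigma>) (cylinder G \<Sigma> A P)"
proof -
  \<comment> \<open>A letter of \<open>P\<close> may lie outside \<open>\<Sigma>\<close>;
    intersecting with \<open>\<Sigma>\<close> keeps the set of letters open in the discrete
    alphabet.\<close>
  have "openin (full_shift G \<Sigma>) {x \<in> topspace (full_shift G \<Sigma>). x a \<in> {P a} \<inter> \<Sigma>}"
    if "a \<in> A" for a
    using that assms
    by (intro openin_continuous_map_preimage[OF continuous_map_full_shift_coordinate]) auto
  then have "openin (full_shift G \<Sigma>) (topspace (full_shift G \<Sigma>) \<inter>
      (\<Inter>a\<in>A. {x \<in> topspace (full_shift G \<Sigma>). x a \<in> {P a} \<inter> \<Sigma>}))"
    \<comment> \<open>The empty window is split off because the intersection rule wants a nonempty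
      family; the cylinder is then the whole space.\<close>
    using assms openin_topspace[of "full_shift G \<Sigma>"]
    by (cases "A = {}") (auto intro!: openin_Int openin_Inter)
  also have "\<dots> = cylinder G \<Sigma> A P"
    using assms by (auto simp: cylinder_def)
  finally show ?thesis .
qed

text \<open>A point is excluded exactly when some shift of it enters some open cylinder, so the
  complement is open for any \<open>\<F>\<close>, even an infinite one. Invariance holds because
  every shift of \<open>shift_act G g x\<close> is again a shift of \<open>x\<close>.\<close>

lemma (in group) subshift_forbidden_patterns:
  assumes "countable (carrier G)" "finite \<Sigma>" "finite A" "A \<subseteq> carrier G"
  shows "subshift G \<Sigma> {x \<in> topspace (full_shift G \<Sigma>).
           \<forall>g\<in>carrier G. \<forall>P\<in>\<F>. shift_act G g x \<notin> cylinder G \<Sigma> A P}" (is "subshift G \<Sigma> ?Y")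
proof -
  interpret F: dynamical_system G "full_shift G \<Sigma>" "shift_act G"
    using assms dynamical_system_full_shift by blast
  have "openin (full_shift G \<Sigma>)
      {x \<in> topspace (full_shift G \<Sigma>). shift_act G g x \<in> cylinder G \<Sigma> A P}"
    if "g \<in> carrier G" for g P
    using that assms(3,4)
    by (intro openin_continuous_map_preimage[OF F.continuous_act openin_cylinder])
  then have "openin (full_shift G \<Sigma>) (\<Union>g\<in>carrier G. \<Union>P\<in>\<F>.
      {x \<in> topspace (full_shift G \<Sigma>). shift_act G g x \<in> cylinder G \<Sigma> A P})"
    by blast
  moreover have "?Y = topspace (full_shift G \<Sigma>) - (\<Union>g\<in>carrier G. \<Union>P\<in>\<F>.
      {x \<in> topspace (full_shift G \<Sigma>). shift_act G g x \<in> cylinder G \<Sigma> A P})"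
    by auto
  ultimately have "closedin (full_shift G \<Sigma>) ?Y"
    by (simp only: closedin_diff closedin_topspace)
  moreover have "shift_act G g x \<in> ?Y" if "g \<in> carrier G" "x \<in> ?Y" for g x
  proof -
    have "shift_act G h (shift_act G g x) = shift_act G (h \<otimes> g) x" if "h \<in> carrier G" for h
      using F.act_mult \<open>g \<in> carrier G\<close> \<open>x \<in> ?Y\<close> that by simp
    then show ?thesis
      using that F.act_closed by auto
  qed
  ultimately show ?thesis
    using assms(2) unfolding subshift_def by (intro conjI ballI image_subsetI)
qed

section \<open>Refining colorings\<close>

text \<open>Each point gets the number of the center of a ball of radius \<open>\<epsilon>/2\<close>
  containing it, so equal colors mean a common ball. Numbering the centers puts the alphabets of all
  levels into the one type \<open>nat\<close>.\<close>

lemma (in Metric_space) ex_finite_coloring: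
  assumes "mtotally_bounded M" "0 < \<epsilon>"
  shows "\<exists>c :: 'a \<Rightarrow> nat. finite (c ` M) \<and> (\<forall>x\<in>M. \<forall>y\<in>M. c x = c y \<longrightarrow> d x y < \<epsilon>)"
proof -
  have "\<exists>K. finite K \<and> K \<subseteq> M \<and> M \<subseteq> (\<Union>k\<in>K. mball k (\<epsilon>/2))"
    using assms unfolding mtotally_bounded_def by simp
  then obtain K where K: "finite K" "M \<subseteq> (\<Union>k\<in>K. mball k (\<epsilon>/2))"
    by blast
  then have "\<forall>x\<in>M. \<exists>k. k \<in> K \<and> x \<in> mball k (\<epsilon>/2)"
    by blast
  then obtain k where k: "\<And>x. x \<in> M \<Longrightarrow> k x \<in> K \<and> x \<in> mball (k x) (\<epsilon>/2)"
    by metis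
  have "finite ((\<lambda>x. to_nat_on K (k x)) ` M)"
    using K k by (intro finite_subset[OF _ finite_imageI[of K "to_nat_on K"]]) auto
  moreover have "d x y < \<epsilon>" if "x \<in> M" "y \<in> M" "to_nat_on K (k x) = to_nat_on K (k y)" for x y
  proof -
    have "k x = k y"
      using that k K to_nat_on_inj[OF countable_finite] by metis
    then have "d (k x) x < \<epsilon>/2" "d (k x) y < \<epsilon>/2" "k x \<in> M"
      using k that by (metis in_mball)+
    then show ?thesis
      using triangle''[of x "k x" y] commute that by (smt (verit) field_sum_of_halves)
  qed
  ultimately show ?thesis
    by (intro exI[of _ "\<lambda>x. to_nat_on K (k x)"]) blast
qed

lemma (in Metric_space) ex_refining_colorings:
  assumes "mtotally_bounded M"
  shows "\<exists>(c :: nat \<Rightarrow> 'a \<Rightarrow> nat) w. (\<forall>n. finite (c n ` M)) \<and>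
           (\<forall>n. \<forall>x\<in>M. w n (c (Suc n) x) = c n x) \<and>
           (\<forall>n. \<forall>x\<in>M. \<forall>y\<in>M. c n x = c n y \<longrightarrow> d x y < inverse (Suc n))"
proof -
  have "\<forall>n. \<exists>q :: 'a \<Rightarrow> nat. finite (q ` M) \<and> (\<forall>x\<in>M. \<forall>y\<in>M. q x = q y \<longrightarrow> d x y < inverse (Suc n))"
    using ex_finite_coloring[OF assms] by simp
  then obtain q :: "nat \<Rightarrow> 'a \<Rightarrow> nat" where fin: "\<And>n. finite (q n ` M)"
    and mesh: "\<And>n x y. \<lbrakk>x \<in> M; y \<in> M; q n x = q n y\<rbrakk> \<Longrightarrow> d x y < inverse (Suc n)"
    by metis
  \<comment> \<open>A color at level \<open>Suc n\<close> pairs the color at level \<open>n\<close>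
    with a fresh one, so it records all earlier colors, and the forgetful map is the first
    projection.\<close>
  define c where "c = rec_nat (q 0) (\<lambda>n f x. prod_encode (f x, q (Suc n) x))"
  have c: "c 0 = q 0" "c (Suc n) = (\<lambda>x. prod_encode (c n x, q (Suc n) x))" for n
    by (simp_all add: c_def)
  have "finite (c n ` M)" for n
  proof (induction n)
    case (Suc n)
    have "c (Suc n) ` M \<subseteq> prod_encode ` (c n ` M \<times> q (Suc n) ` M)"
      by (auto simp: c)
    then show ?case
      using Suc fin by (meson finite_SigmaI finite_imageI finite_subset)
  qed (simp add: c fin)
  moreover have "q n x = q n y" if "c n x = c n y" for n x y
    using that by (cases n) (auto simp: c)
  moreover have "(\<lambda>k. fst (prod_decode k)) (c (Suc n) x) = c n x" for n x
    by (simp add: c)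
  ultimately show ?thesis
    using mesh by (intro exI[of _ c] exI[of _ "\<lambda>_ k. fst (prod_decode k)"]) blast
qed

section \<open>The inverse system of an action with shadowing\<close>

locale coded_action =
  Metric_space M d + dynamical_system G "Metric_space.mtopology M d" \<Phi>
  for M :: "'a set" and d and G :: "('g, 'm) monoid_scheme" (structure) and \<Phi> +
  fixes S :: "'g set" and c :: "nat \<Rightarrow> 'a \<Rightarrow> nat" and w :: "nat \<Rightarrow> nat \<Rightarrow> nat"
  assumes finite_S: "finite S" and S_carrier: "S \<subseteq> carrier G"
    and shadowing: "shadowing_property G M d \<Phi> S"
    and finite_colors: "finite (c n ` M)"
    and refining: "x \<in> M \<Longrightarrow> w n (c (Suc n) x) = c n x"
    and mesh: "\<lbrakk>x \<in> M; y \<in> M; c n x = c n y\<rbrakk> \<Longrightarrow> d x y < inverse (Suc n)"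
begin

text \<open>The witness \<open>x\<close> may change with \<open>g\<close> and \<open>s\<close>, so
  the rule couples only the two sites \<open>g\<close> and \<open>s \<otimes> g\<close>; no single
  point has to follow all of \<open>u\<close>.\<close>

definition itineraries :: "nat \<Rightarrow> ('g \<Rightarrow> nat) set" where
  "itineraries n = {u \<in> carrier G \<rightarrow>\<^sub>E c n ` M.
     \<forall>g\<in>carrier G. \<forall>s\<in>S. \<exists>x\<in>M. c n x = u g \<and> c n (\<Phi> s x) = u (s \<otimes> g)}"

definition coarsen :: "nat \<Rightarrow> ('g \<Rightarrow> nat) \<Rightarrow> 'g \<Rightarrow> nat" where
  "coarsen n u = (\<lambda>h\<in>carrier G. w n (u h))"

abbreviation itinerary_space :: "nat \<Rightarrow> ('g \<Rightarrow> nat) topology" where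
  "itinerary_space n \<equiv> subshift_space G (c n ` M) (itineraries n)"

abbreviation tower :: "(nat \<Rightarrow> 'g \<Rightarrow> nat) topology" where
  "tower \<equiv> inverse_limit itinerary_space coarsen"

lemma act_in_M: "\<lbrakk>g \<in> carrier G; x \<in> M\<rbrakk> \<Longrightarrow> \<Phi> g x \<in> M"
  using act_closed by simp

text \<open>Forbidden are the patterns in which, for some \<open>s\<close>, the letters at
  \<open>\<one>\<close> and \<open>s\<close> are not the colors of a point and its image under
  \<open>\<Phi> s\<close>. Shifting by \<open>g\<close> brings the letters at \<open>g\<close> and
  \<open>s \<otimes> g\<close> to these two sites.\<close>

lemma itineraries_sft: "shift_of_finite_type G (c n ` M) (S \<union> {\<one>}) (itineraries n)"
proof -
  let ?A = "S \<union> {\<one>}" and ?\<Sigma> = "c n ` M"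
  let ?\<F> = "{P \<in> ?A \<rightarrow>\<^sub>E ?\<Sigma>. \<exists>s\<in>S. \<forall>x\<in>M. \<not> (c n x = P \<one> \<and> c n (\<Phi> s x) = P s)}"
  have A: "finite ?A" "?A \<subseteq> carrier G"
    using finite_S S_carrier by auto
  have "u \<in> itineraries n \<longleftrightarrow> (\<forall>g\<in>carrier G. \<forall>P\<in>?\<F>. shift_act G g u \<notin> cylinder G ?\<Sigma> ?A P)"
    if u: "u \<in> topspace (full_shift G ?\<Sigma>)" for u
  proof safe
    fix g P s
    assume *: "u \<in> itineraries n" "g \<in> carrier G" "s \<in> S" "shift_act G g u \<in> cylinder G ?\<Sigma> ?A P"
      "\<forall>x\<in>M. \<not> (c n x = P \<one> \<and> c n (\<Phi> s x) = P s)"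
    then have "P a = u (a \<otimes> g)" if "a \<in> ?A" for a
      using that A(2) unfolding cylinder_def shift_act_def by fastforce
    then have "P \<one> = u g" "P s = u (s \<otimes> g)"
      using *(2,3) by auto
    moreover have "\<exists>x\<in>M. c n x = u g \<and> c n (\<Phi> s x) = u (s \<otimes> g)"
      using *(1-3) unfolding itineraries_def by blast
    ultimately show False
      using *(5) by auto
  next
    assume *: "\<forall>g\<in>carrier G. \<forall>P\<in>?\<F>. shift_act G g u \<notin> cylinder G ?\<Sigma> ?A P"
    have "\<exists>x\<in>M. c n x = u g \<and> c n (\<Phi> s x) = u (s \<otimes> g)" if g: "g \<in> carrier G" and s: "s \<in> S" for g s
    proof (rule ccontr)
      assume neg: "\<not> ?thesis"
      \<comment> \<open>The window of \<open>u\<close> seen from \<open>g\<close> is itself a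
        forbidden pattern, and the shifted \<open>u\<close> lies in its cylinder by
        construction.\<close>
      let ?P = "restrict (shift_act G g u) ?A"
      have u': "shift_act G g u \<in> carrier G \<rightarrow>\<^sub>E ?\<Sigma>"
        using u g by (auto simp: shift_act_def PiE_iff)
      then have "?P \<in> ?A \<rightarrow>\<^sub>E ?\<Sigma>"
        using A(2) by (auto simp: PiE_iff)
      moreover have "?P \<one> = u g" "?P s = u (s \<otimes> g)"
        using g s S_carrier by (auto simp: shift_act_def)
      ultimately have "?P \<in> ?\<F>"
        using neg s by (intro CollectI conjI bexI[of _ s] ballI) auto
      moreover have "shift_act G g u \<in> cylinder G ?\<Sigma> ?A ?P"
        using u' by (auto simp: cylinder_def)
      ultimately show False
        using * g by blast
    qed
    then show "u \<in> itineraries n"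
      using u by (simp add: itineraries_def)
  qed
  moreover have "itineraries n \<subseteq> topspace (full_shift G ?\<Sigma>)"
    by (auto simp: itineraries_def)
  ultimately have eq: "itineraries n = {u \<in> topspace (full_shift G ?\<Sigma>).
      \<forall>g\<in>carrier G. \<forall>P\<in>?\<F>. shift_act G g u \<notin> cylinder G ?\<Sigma> ?A P}"
    by (rule eq_CollectI)
  have "subshift G ?\<Sigma> (itineraries n)"
    unfolding eq by (rule subshift_forbidden_patterns[OF countable_group finite_colors A])
  then show ?thesis
    unfolding shift_of_finite_type_def
    by (intro conjI exI[of _ ?\<F>] A eq Collect_restrict)
qed

lemma topspace_itinerary_space [simp]: "topspace (itinerary_space n) = itineraries n"
  by (auto simp: subshift_space_def itineraries_def)

lemma continuous_map_coordinate:
  "h \<in> carrier G \<Longrightarrow> continuous_map (itinerary_space n) (discrete_topology (c n ` M)) (\<lambda>u. u h)"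
  unfolding subshift_space_def
  by (intro continuous_map_from_subtopology continuous_map_full_shift_coordinate)

text \<open>A point that realizes two finer colors also realizes their coarsenings, so the same
  witness serves.\<close>

lemma coarsen_itinerary:
  assumes "u \<in> itineraries (Suc n)"
  shows "coarsen n u \<in> itineraries n"
proof -
  have "w n (u h) \<in> c n ` M" if "h \<in> carrier G" for h
    using assms that refining by (force simp: itineraries_def PiE_iff)
  moreover have "\<exists>x\<in>M. c n x = w n (u g) \<and> c n (\<Phi> s x) = w n (u (s \<otimes> g))"
    if g: "g \<in> carrier G" and s: "s \<in> S" for g s
  proof -
    have "\<exists>x\<in>M. c (Suc n) x = u g \<and> c (Suc n) (\<Phi> s x) = u (s \<otimes> g)"
      using assms g s unfolding itineraries_def by blast
    then obtain x where "x \<in> M" "c (Suc n) x = u g" "c (Suc n) (\<Phi> s x) = u (s \<otimes> g)"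
      by blast
    moreover from this have "\<Phi> s x \<in> M"
      using act_in_M s S_carrier by blast
    ultimately show ?thesis
      using refining by metis
  qed
  ultimately show ?thesis
    using S_carrier by (auto simp: itineraries_def coarsen_def)
qed

lemma inverse_system_itineraries:
  "inverse_system G itinerary_space (\<lambda>n. shift_act G) coarsen"
  unfolding inverse_system_def
proof (intro conjI allI ballI)
  show "dynamical_system G (itinerary_space n) (shift_act G)" for n
    using itineraries_sft dynamical_system_subshift countable_group
    unfolding shift_of_finite_type_def by blast
  show "continuous_map (itinerary_space (Suc n)) (itinerary_space n) (coarsen n)" for n
  proof -
    have "continuous_map (itinerary_space (Suc n)) (discrete_topology (c n ` M)) (\<lambda>u. coarsen n u h)"
      if h: "h \<in> carrier G" for h
    proof -
      have "continuous_map (discrete_topology (c (Suc n) ` M)) (discrete_topology (c n ` M)) (w n)"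
        using refining by auto
      then have "continuous_map (itinerary_space (Suc n)) (discrete_topology (c n ` M)) (w n \<circ> (\<lambda>u. u h))"
        by (rule continuous_map_compose[OF continuous_map_coordinate[OF h]])
      then show ?thesis
        using h by (simp add: coarsen_def o_def)
    qed
    then have "continuous_map (itinerary_space (Suc n)) (full_shift G (c n ` M)) (coarsen n)"
      by (intro continuous_map_into_full_shift) (auto simp: coarsen_def)
    then show ?thesis
      using coarsen_itinerary unfolding subshift_space_def[of _ "c n ` M"]
      by (intro continuous_map_into_subtopology) auto
  qed
  show "coarsen n (shift_act G g u) = shift_act G g (coarsen n u)" if "g \<in> carrier G" for n g u
    using that by (auto simp: coarsen_def shift_act_def)
qed

lemma topspace_tower:
  "u \<in> topspace tower \<longleftrightarrow> (\<forall>n. u n \<in> itineraries n \<and> u n = coarsen n (u (Suc n)))"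
  by (simp add: inverse_limit_def PiE_iff all_conj_distrib)

lemma dynamical_system_tower:
  "dynamical_system G tower (coordinatewise_act (\<lambda>n. shift_act G))"
  using dynamical_system_inverse_limit countable_group inverse_system_itineraries .

subsection \<open>The point coded by a sequence of colors\<close>

text \<open>The point \<open>z\<close> need not carry the colors \<open>k n\<close> itself, since
  color classes need not be closed. The bound is non-strict so that it survives passage to a
  limit.\<close>

definition codes :: "(nat \<Rightarrow> nat) \<Rightarrow> 'a \<Rightarrow> bool" where
  "codes k z \<longleftrightarrow> z \<in> M \<and> (\<forall>n. \<forall>x\<in>M. c n x = k n \<longrightarrow> d z x \<le> inverse (Suc n))"

text \<open>Representatives \<open>p n\<close> of the classes form a Cauchy sequence because later
  ones lie in all earlier classes; compactness gives completeness, and the limit is the coded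
  point.\<close>

lemma codes_exists:
  assumes k: "\<And>n. k n \<in> c n ` M" "\<And>n. k n = w n (k (Suc n))"
  shows "\<exists>z. codes k z"
proof -
  have "\<exists>x\<in>M. c n x = k n" for n
    using k(1)[of n] by (auto simp: image_iff)
  then obtain p where p: "\<And>n. p n \<in> M" "\<And>n. c n (p n) = k n"
    by metis
  \<comment> \<open>Here \<open>n\<close> must vary in the induction: the color of the same point at
    level \<open>Suc n\<close> is known, and \<open>w n\<close> brings it down to level
    \<open>n\<close>.\<close>
  have col: "c n (p (n + m)) = k n" for n m
  proof (induction m arbitrary: n)
    case (Suc m)
    have "c (Suc n) (p (n + Suc m)) = k (Suc n)"
      using Suc.IH[of "Suc n"] by simp
    then show ?case
      using k(2)[of n] refining[of "p (n + Suc m)" n] p(1) by simp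
  qed (simp add: p)
  then have near: "d x (p m) < inverse (Suc n)" if "x \<in> M" "c n x = k n" "n \<le> m" for x n m
    using mesh[of x "p m" n] p that by (metis le_add_diff_inverse)
  have "MCauchy p"
    unfolding MCauchy_def
  proof (intro conjI strip)
    fix \<epsilon> :: real assume "0 < \<epsilon>"
    then obtain N where N: "inverse (Suc N) < \<epsilon> / 2"
      using reals_Archimedean half_gt_zero by blast
    have "d (p n) (p n') < \<epsilon>" if "N \<le> n" "N \<le> n'" for n n'
      using near[of "p N" N n] near[of "p N" N n'] p N that
        triangle''[of "p n" "p N" "p n'"] commute[of "p n" "p N"] by fastforce
    then show "\<exists>N. \<forall>n n'. N \<le> n \<longrightarrow> N \<le> n' \<longrightarrow> d (p n) (p n') < \<epsilon>"
      by blast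
  qed (use p in auto)
  then obtain z where z: "limitin mtopology p z sequentially"
    using compact compact_space_imp_mcomplete mcomplete_def by blast
  then have zM: "z \<in> M"
    using limitin_mspace by blast
  have "d z x \<le> inverse (Suc n)" if x: "x \<in> M" "c n x = k n" for n x
  proof (rule field_le_epsilon)
    fix e :: real assume "0 < e"
    then obtain N where N: "\<And>m. m \<ge> N \<Longrightarrow> d (p m) z < e"
      using z unfolding limit_metric_sequentially by blast
    have "d (p (max n N)) z < e" "d x (p (max n N)) < inverse (Suc n)"
      using N near x by auto
    then show "d z x \<le> inverse (Suc n) + e"
      using triangle[of x "p (max n N)" z] commute[of z x] x zM p by fastforce
  qed
  then show ?thesis
    using zM by (auto simp: codes_def)
qed

text \<open>Both points are near any representative of the shared color. For equal sequences this
  yields uniqueness; for sequences agreeing at one level it yields continuity of the factor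
  map.\<close>

lemma codes_dist_le:
  assumes "codes k z" "codes k' z'" "k n = k' n" "k n \<in> c n ` M"
  shows "d z z' \<le> 2 * inverse (Suc n)"
proof -
  obtain x where "x \<in> M" "c n x = k n"
    using assms by auto
  then have "d z x \<le> inverse (Suc n)" "d z' x \<le> inverse (Suc n)" "z \<in> M" "z' \<in> M"
    using assms unfolding codes_def by auto
  then show ?thesis
    using triangle'[of z x z'] \<open>x \<in> M\<close> by simp
qed

lemma codes_unique:
  assumes "codes k z" "codes k z'" "\<And>n. k n \<in> c n ` M"
  shows "z = z'"
proof (rule ccontr)
  assume "z \<noteq> z'"
  then have "0 < d z z'"
    using assms mdist_pos_less by (auto simp: codes_def)
  then obtain n where "inverse (Suc n) < d z z' / 2"
    using reals_Archimedean half_gt_zero by blast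
  then show False
    using codes_dist_le[OF assms(1,2) refl assms(3), of n] by simp
qed

lemma codes_colors: "z \<in> M \<Longrightarrow> codes (\<lambda>n. c n z) z"
  unfolding codes_def using mesh[of z] less_imp_le by metis

lemma codes_tower:
  assumes u: "u \<in> topspace tower" and g: "g \<in> carrier G"
  shows "u n g \<in> c n ` M" "\<exists>z. codes (\<lambda>n. u n g) z"
proof -
  have "u n \<in> itineraries n" for n
    using u unfolding topspace_tower by blast
  then show *: "u n g \<in> c n ` M" for n
    using g unfolding itineraries_def by blast
  have "u n g = w n (u (Suc n) g)" for n
    using u g unfolding topspace_tower coarsen_def by (metis restrict_apply')
  with * show "\<exists>z. codes (\<lambda>n. u n g) z"
    by (intro codes_exists)
qed

section \<open>From itineraries to pseudo-orbits, and equivariance by shadowing\<close>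

lemma eventually_pseudo_orbit:
  assumes "0 < \<delta>"
  shows "\<exists>N. \<forall>n\<ge>N. \<forall>u\<in>itineraries n. \<forall>x.
    (\<forall>g\<in>carrier G. x g \<in> M \<and> c n (x g) = u g) \<longrightarrow> pseudo_orbit G M d \<Phi> S \<delta> x"
proof -
  \<comment> \<open>Compactness makes each \<open>\<Phi> s\<close> uniformly continuous, and
    finiteness of \<open>S\<close> then allows one threshold for all \<open>s\<close>; hence
    \<open>N\<close> depends neither on \<open>u\<close> nor on \<open>x\<close>.\<close>
  have "\<exists>\<eta>>0. \<forall>x\<in>M. \<forall>y\<in>M. d y x < \<eta> \<longrightarrow> d (\<Phi> s y) (\<Phi> s x) < \<delta> / 2" if "s \<in> S" for s
  proof -
    have "uniformly_continuous_map (metric (M, d)) (metric (M, d)) (\<Phi> s)"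
      using compact continuous_act that S_carrier
      by (intro continuous_imp_uniformly_continuous_map) auto
    then have "\<forall>\<epsilon>>0. \<exists>\<eta>>0. \<forall>x\<in>M. \<forall>y\<in>M. d y x < \<eta> \<longrightarrow> d (\<Phi> s y) (\<Phi> s x) < \<epsilon>"
      by (simp add: uniformly_continuous_map_def)
    then show ?thesis
      using half_gt_zero[OF assms] by blast
  qed
  then obtain \<eta> where \<eta>: "\<And>s. s \<in> S \<Longrightarrow> 0 < \<eta> s"
    and uc: "\<And>s x y. \<lbrakk>s \<in> S; x \<in> M; y \<in> M; d y x < \<eta> s\<rbrakk> \<Longrightarrow> d (\<Phi> s y) (\<Phi> s x) < \<delta> / 2"
    by metis
  \<comment> \<open>Including \<open>\<delta> / 2\<close> controls the second error below and also
    keeps \<open>Min\<close> meaningful when \<open>S\<close> is empty.\<close>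
  define \<theta> where "\<theta> = Min (insert (\<delta> / 2) (\<eta> ` S))"
  have \<theta>: "\<theta> \<le> \<delta> / 2" "\<And>s. s \<in> S \<Longrightarrow> \<theta> \<le> \<eta> s"
    unfolding \<theta>_def using finite_S by (intro Min_le; simp)+
  have "0 < \<theta>"
    using finite_S \<eta> assms by (simp add: \<theta>_def)
  then obtain N where N: "inverse (Suc N) < \<theta>"
    using reals_Archimedean by blast
  have "d (\<Phi> s (x g)) (x (s \<otimes> g)) < \<delta>"
    if n: "N \<le> n" and u: "u \<in> itineraries n" and x: "\<forall>g\<in>carrier G. x g \<in> M \<and> c n (x g) = u g"
      and g: "g \<in> carrier G" and s: "s \<in> S" for n u x g s
  proof -
    \<comment> \<open>The witness \<open>y\<close> of the local rule links the two representatives: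
      \<open>x g\<close> and \<open>y\<close> share a color, and so do \<open>\<Phi> s y\<close> and
      \<open>x (s \<otimes> g)\<close>. After applying \<open>\<Phi> s\<close> to the first pair,
      each link costs less than \<open>\<delta> / 2\<close>.\<close>
    have "\<exists>y\<in>M. c n y = u g \<and> c n (\<Phi> s y) = u (s \<otimes> g)"
      using u g s unfolding itineraries_def by blast
    then obtain y where y: "y \<in> M" "c n y = u g" "c n (\<Phi> s y) = u (s \<otimes> g)"
      by blast
    have sC: "s \<in> carrier G" "s \<otimes> g \<in> carrier G"
      using s g S_carrier by auto
    have "inverse (Suc n) \<le> inverse (Suc N)"
      using n by (intro le_imp_inverse_le) auto
    then have le: "inverse (Suc n) < \<theta>"
      using N by linarith
    have "d (x g) y < \<eta> s"
      using mesh[of "x g" y n] x g y le \<theta>(2)[OF s] by fastforce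
    then have "d (\<Phi> s (x g)) (\<Phi> s y) < \<delta> / 2"
      using uc s x g y by blast
    moreover have "d (\<Phi> s y) (x (s \<otimes> g)) < \<delta> / 2"
      using mesh[of "\<Phi> s y" "x (s \<otimes> g)" n] act_in_M x sC y le \<theta>(1) by fastforce
    ultimately show ?thesis
      using triangle[of "\<Phi> s (x g)" "\<Phi> s y" "x (s \<otimes> g)"] act_in_M x g sC y by fastforce
  qed
  then show ?thesis
    unfolding pseudo_orbit_def by blast
qed

text \<open>Without shadowing this could fail for \<open>g\<close> outside the subgroup generated by \<open>S\<close>.\<close>

lemma codes_equivariant:
  assumes u: "u \<in> topspace tower" and g: "g \<in> carrier G"
    and z: "codes (\<lambda>n. u n \<one>) z" and y: "codes (\<lambda>n. u n g) y"
  shows "y = \<Phi> g z"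
proof (rule ccontr)
  assume "y \<noteq> \<Phi> g z"
  have M: "z \<in> M" "y \<in> M" "\<Phi> g z \<in> M"
    using z y g act_in_M by (auto simp: codes_def)
  define e where "e = d (\<Phi> g z) y"
  have e: "0 < e"
    using M \<open>y \<noteq> \<Phi> g z\<close> by (auto simp: e_def)
  obtain \<eta> where "0 < \<eta>" and \<eta>: "\<And>p. \<lbrakk>p \<in> M; d z p < \<eta>\<rbrakk> \<Longrightarrow> d (\<Phi> g z) (\<Phi> g p) < e / 2"
    using continuous_act[OF g] M(1) e metric_continuous_map[OF Metric_space_axioms, of "\<Phi> g"]
    by (meson half_gt_zero)
  \<comment> \<open>Shadowing error and coding error, each below \<open>\<epsilon>\<close>, add up.
    At \<open>\<one>\<close> the sum must stay below \<open>\<eta>\<close>, for continuity of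
    \<open>\<Phi> g\<close> at \<open>z\<close>; at \<open>g\<close> it must stay below
    \<open>e / 2\<close>.\<close>
  define \<epsilon> where "\<epsilon> = min \<eta> (e / 2) / 2"
  have \<epsilon>: "0 < \<epsilon>" "2 * \<epsilon> \<le> \<eta>" "2 * \<epsilon> \<le> e / 2"
    using e \<open>0 < \<eta>\<close> by (auto simp: \<epsilon>_def)
  obtain \<delta> where "0 < \<delta>"
    and \<delta>: "\<And>x. pseudo_orbit G M d \<Phi> S \<delta> x \<Longrightarrow> \<exists>p\<in>M. shadows G d \<Phi> \<epsilon> p x"
    using shadowing \<epsilon>(1) unfolding shadowing_property_def by blast
  obtain N where N: "\<And>n u x. \<lbrakk>N \<le> n; u \<in> itineraries n; \<forall>g\<in>carrier G. x g \<in> M \<and> c n (x g) = u g\<rbrakk>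
      \<Longrightarrow> pseudo_orbit G M d \<Phi> S \<delta> x"
    using eventually_pseudo_orbit[OF \<open>0 < \<delta>\<close>] by blast
  obtain K where K: "inverse (Suc K) < \<epsilon>"
    using reals_Archimedean \<epsilon>(1) by blast
  \<comment> \<open>\<open>N\<close> makes representatives a pseudo-orbit, and \<open>K\<close>
    brings the coding error below \<open>\<epsilon>\<close>.\<close>
  define n where "n = max N K"
  have "inverse (Suc n) \<le> inverse (Suc K)"
    by (intro le_imp_inverse_le) (auto simp: n_def)
  then have n: "inverse (Suc n) < \<epsilon>" "N \<le> n"
    using K by (simp_all only: n_def max.cobounded1 le_less_trans)
  have "\<forall>h\<in>carrier G. \<exists>x. x \<in> M \<and> c n x = u n h"
    using codes_tower(1)[OF u] by (metis imageE)
  then obtain x where x: "\<forall>h\<in>carrier G. x h \<in> M \<and> c n (x h) = u n h"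
    by metis
  have "u n \<in> itineraries n"
    using u unfolding topspace_tower by blast
  then have "pseudo_orbit G M d \<Phi> S \<delta> x"
    using N n(2) x by blast
  then obtain p where p: "p \<in> M" and sh: "\<And>h. h \<in> carrier G \<Longrightarrow> d (\<Phi> h p) (x h) < \<epsilon>"
    using \<delta> unfolding shadows_def by blast
  have "d z (x \<one>) \<le> inverse (Suc n)" "d y (x g) \<le> inverse (Suc n)"
    using z y x g unfolding codes_def by auto
  moreover have "d p (x \<one>) < \<epsilon>" "d (\<Phi> g p) (x g) < \<epsilon>"
    using sh[of \<one>] sh[OF g] act_one p by auto
  ultimately have "d z p < 2 * \<epsilon>" "d (\<Phi> g p) y < 2 * \<epsilon>"
    using triangle'[of z "x \<one>" p] triangle'[of "\<Phi> g p" "x g" y] x g M p act_in_M n(1) by fastforce+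
  \<comment> \<open>The two halves add up to less than \<open>e\<close>, which is the distance from
    \<open>\<Phi> g z\<close> to \<open>y\<close>.\<close>
  then have "d (\<Phi> g z) (\<Phi> g p) < e / 2" "d (\<Phi> g p) y < e / 2"
    using \<eta> p \<epsilon> by auto
  then show False
    using triangle[of "\<Phi> g z" "\<Phi> g p" y] M p g act_in_M by (fastforce simp: e_def)
qed

section \<open>The factor map from the inverse limit\<close>

lemma factor_of_tower:
  "factor_of G mtopology \<Phi> tower (coordinatewise_act (\<lambda>n. shift_act G))"
proof -
  interpret T: dynamical_system G tower "coordinatewise_act (\<lambda>n. shift_act G)"
    by (rule dynamical_system_tower)
  define \<pi> where "\<pi> u = (SOME z. codes (\<lambda>n. u n \<one>) z)" for u :: "nat \<Rightarrow> 'g \<Rightarrow> nat"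
  have \<pi>: "codes (\<lambda>n. u n \<one>) (\<pi> u)" if "u \<in> topspace tower" for u
    unfolding \<pi>_def using codes_tower(2)[OF that one_closed] by (rule someI_ex)
  have \<pi>_eq: "\<pi> u = z" if "u \<in> topspace tower" "codes (\<lambda>n. u n \<one>) z" for u z
    using codes_unique \<pi> codes_tower(1) that by blast
  have "continuous_map tower mtopology \<pi>"
    unfolding continuous_map_to_metric
  proof (intro ballI allI impI)
    fix u and \<epsilon> :: real assume u: "u \<in> topspace tower" and "0 < \<epsilon>"
    then obtain n where n: "inverse (Suc n) < \<epsilon> / 2"
      using reals_Archimedean half_gt_zero by blast
    \<comment> \<open>Fixing one letter at one level is an open condition, and by
      \<open>codes_dist_le\<close> it already forces the images to be closer than
      \<open>\<epsilon>\<close>.\<close>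
    let ?U = "{v \<in> topspace tower. v n \<one> \<in> {u n \<one>}}"
    have "continuous_map tower (itinerary_space n) (\<lambda>v. v n)"
      unfolding inverse_limit_def
      by (intro continuous_map_from_subtopology continuous_map_product_projection) simp
    then have "continuous_map tower (discrete_topology (c n ` M)) ((\<lambda>u. u \<one>) \<circ> (\<lambda>v. v n))"
      by (rule continuous_map_compose[OF _ continuous_map_coordinate[OF one_closed]])
    then have "continuous_map tower (discrete_topology (c n ` M)) (\<lambda>v. v n \<one>)"
      by (simp add: o_def)
    then have "openin tower ?U"
      using codes_tower(1)[OF u one_closed] by (intro openin_continuous_map_preimage) auto
    moreover have "\<pi> v \<in> mball (\<pi> u) \<epsilon>" if "v \<in> ?U" for v
    proof -
      have "d (\<pi> u) (\<pi> v) \<le> 2 * inverse (Suc n)"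
        using that u codes_tower(1) by (intro codes_dist_le[OF \<pi> \<pi>]) auto
      then show ?thesis
        using n \<pi>[OF u] \<pi>[of v] that by (auto simp: codes_def)
    qed
    ultimately show "\<exists>U. openin tower U \<and> u \<in> U \<and> (\<forall>v\<in>U. \<pi> v \<in> mball (\<pi> u) \<epsilon>)"
      using u by blast
  qed
  moreover have "\<pi> ` topspace tower = topspace mtopology"
  proof
    show "\<pi> ` topspace tower \<subseteq> topspace mtopology"
      using \<pi> by (auto simp: codes_def)
    show "topspace mtopology \<subseteq> \<pi> ` topspace tower"
    proof
      fix z assume "z \<in> topspace mtopology"
      then have z: "z \<in> M"
        by simp
      \<comment> \<open>This is the itinerary of \<open>z\<close> under the whole action; the
        witness of the local rule at \<open>g\<close> and \<open>s\<close> is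
        \<open>\<Phi> g z\<close>.\<close>
      define u where "u n = (\<lambda>h\<in>carrier G. c n (\<Phi> h z))" for n
      have "\<Phi> (s \<otimes> g) z = \<Phi> s (\<Phi> g z)" if "s \<in> S" "g \<in> carrier G" for s g
        using that z S_carrier act_mult by auto
      then have "u n \<in> itineraries n" for n
        using z act_in_M S_carrier by (fastforce simp: u_def itineraries_def)
      moreover have "u n = coarsen n (u (Suc n))" for n
        using z act_in_M refining by (auto simp: u_def coarsen_def)
      ultimately have "u \<in> topspace tower"
        unfolding topspace_tower by blast
      moreover have "codes (\<lambda>n. u n \<one>) z"
        using codes_colors[OF z] act_one z by (simp add: u_def)
      ultimately show "z \<in> \<pi> ` topspace tower"
        using \<pi>_eq by force
    qed
  qed
  moreover have "\<Phi> g (\<pi> u) = \<pi> (coordinatewise_act (\<lambda>n. shift_act G) g u)"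
    if g: "g \<in> carrier G" and u: "u \<in> topspace tower" for g u
  proof -
    obtain y where y: "codes (\<lambda>n. u n g) y"
      using codes_tower(2)[OF u g] by blast
    \<comment> \<open>The letters of the shifted point at \<open>\<one>\<close> are those of
      \<open>u\<close> at \<open>g\<close>, and these code \<open>y\<close>.\<close>
    then have "\<pi> (coordinatewise_act (\<lambda>n. shift_act G) g u) = y"
      using T.act_closed[OF g u] g
      by (intro \<pi>_eq) (auto simp: coordinatewise_act_def shift_act_def)
    then show ?thesis
      using codes_equivariant[OF u g \<pi>[OF u] y] by simp
  qed
  ultimately show ?thesis
    unfolding factor_of_def
    using dynamical_system_axioms T.dynamical_system_axioms by blast
qed

end

theorem theorem1p3:
  fixes G :: "('g, 'm) monoid_scheme"
    and M :: "'a set" and d :: "'a \<Rightarrow> 'a \<Rightarrow> real"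
    and \<Phi> :: "'g \<Rightarrow> 'a \<Rightarrow> 'a" and S :: "'g set"
  assumes "Metric_space M d"
    and "dynamical_system G (Metric_space.mtopology M d) \<Phi>"
    and "finite S" and "S \<subseteq> carrier G"
    and "shadowing_property G M d \<Phi> S"
  shows "\<exists>(\<Sigma> :: nat \<Rightarrow> nat set) (X :: nat \<Rightarrow> ('g \<Rightarrow> nat) set)
           (\<phi> :: nat \<Rightarrow> ('g \<Rightarrow> nat) \<Rightarrow> ('g \<Rightarrow> nat)).
      (\<forall>n. shift_of_finite_type G (\<Sigma> n) (S \<union> {\<one>\<^bsub>G\<^esub>}) (X n)) \<and>
      inverse_system G (\<lambda>n. subshift_space G (\<Sigma> n) (X n)) (\<lambda>n. shift_act G) \<phi> \<and>
      factor_of G (Metric_space.mtopology M d) \<Phi>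
        (inverse_limit (\<lambda>n. subshift_space G (\<Sigma> n) (X n)) \<phi>)
        (coordinatewise_act (\<lambda>n. shift_act G))"
proof -
  interpret Metric_space M d
    by fact
  interpret D: dynamical_system G mtopology \<Phi>
    by fact
  have "mtotally_bounded M"
    using D.compact compact_space_eq_mcomplete_mtotally_bounded by blast
  then obtain c :: "nat \<Rightarrow> 'a \<Rightarrow> nat" and w where
    "\<And>n. finite (c n ` M)" "\<And>n x. x \<in> M \<Longrightarrow> w n (c (Suc n) x) = c n x"
    "\<And>n x y. \<lbrakk>x \<in> M; y \<in> M; c n x = c n y\<rbrakk> \<Longrightarrow> d x y < inverse (Suc n)"
    using ex_refining_colorings by blast
  then interpret coded_action M d G \<Phi> S c w
    using assms(3-5) by unfold_locales
  show ?thesis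
    using itineraries_sft inverse_system_itineraries factor_of_tower
    by (intro exI[of _ "\<lambda>n. c n ` M"] exI[of _ itineraries] exI[of _ coarsen]) simp
qed

end
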